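(* Let $S=\{(\boldsymbol x_i,y_i)\}_{i=1}^n$ be a dataset of size $n$ sampled i.i.d. from the joint distribution $p^*_{X,Y}=p^*_{X\vert Y}\,p^*_Y$ on $\mathscr X\times\mathscr Y$. Let $\mathcal P_{X\vert Y}$ be a conditional distribution space and let $\hat p_{X\vert Y}$ be a maximizer over $p_{X\vert Y}\in\mathcal P_{X\vert Y}$ of the conditional likelihood $\mathcal L_S(p_{X\vert Y})=\prod_{i=1}^n p_{X\vert Y}(\boldsymbol x_i\vert y_i)$. Suppose the true conditional distribution $p^*_{X\vert Y}$ belongs to $\mathcal P_{X\vert Y}$. Then for any $0<\delta\le 1/2$, with probability at least $1-\delta$ over the draw of $S$, $$\mathcal R_{\overline{\mathrm{TV}}}(\hat p_{X\vert Y})\le 3\sqrt{\frac1n\left(\log \mathcal N_{[]}\!\left(\tfrac1n;\mathcal P_{X\vert Y},L^1(\mathscr X)\right)+\log\frac1\delta\right)}.$$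
   Context: $X$ is a random variable with values in a data space $\mathscr X$ (continuous, with densities with respect to Lebesgue measure, or discrete, with probability mass functions and integrals read as sums). $Y$ is a source label with values in the label space $\mathscr Y=\{1,\dots,K\}$, with distribution $p_Y^*$. A conditional distribution space $\mathcal P_{X\vert Y}$ is a set of functions $(\boldsymbol x,y)\mapsto p_{X\vert Y}(\boldsymbol x\vert y)$ such that for each $y\in\mathscr Y$, $p_{X\vert Y}(\cdot\vert y)$ is a probability density (mass) function on $\mathscr X$. Average TV error: $\mathcal R_{\overline{\mathrm{TV}}}(\hat p_{X\vert Y})=\mathbb E_{Y\sim p_Y^*}\left[\frac12\int_{\mathscr X}\left|\hat p_{X\vert Y}(\boldsymbol x\vert Y)-p^*_{X\vert Y}(\boldsymbol x\vert Y)\right|d\boldsymbol x\right]$. Upper bracketing number: for $\epsilon>0$ and $1\le \mathsf p\le\infty$, an $\epsilon$-upper bracket of $\mathcal P_{X\vert Y}$ with respect to $L^{\mathsf p}(\mathscr X)$ is a finite set $\mathcal B$ of functions on $\mathscr X\times\mathscr Y$ such that for any $p_{X\vert Y}\in\mathcal P_{X\vert Y}$ there is $p'\in\mathcal B$ such that for every $y\in\mathscr Y$: $p'(\boldsymbol x,y)\ge p_{X\vert Y}(\boldsymbol x\vert y)$ for all $\boldsymbol x\in\mathscr X$, and $\|p'(\cdot,y)-p_{X\vert Y}(\cdot\vert y)\|_{L^{\mathsf p}(\mathscr X)}\le\epsilon$. The $\epsilon$-upper bracketing number $\mathcal N_{[]}(\epsilon;\mathcal P_{X\vert Y},L^{\mathsf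 p}(\mathscr X))$ is the cardinality of the smallest $\epsilon$-upper bracket (infinite if none exists). *)

theory Defs
  imports "HOL-Probability.Probability"
begin

text \<open>
  The data space is given by a sigma-finite base measure \<open>mu\<close>: the points of the data space are
  \<open>space mu\<close>, and densities and integrals over the data space are taken with respect to \<open>mu\<close>.
  The following instances are the continuous case (densities with respect to Lebesgue measure on a
  measurable subset of a Euclidean space) and the discrete case (probability mass functions;
  integrals with respect to the counting measure are sums).
\<close>

lemma sigma_finite_data_space_lborel:
  fixes A :: "'a::euclidean_space set"
  assumes "A \<in> sets borel"
  shows "sigma_finite_measure (restrict_space lborel A)"
  using assms by (intro sigma_finite_measure_restrict_space) (auto intro: sigma_finite_lborel)

lemma sigma_finite_data_space_discrete:
  "countable A \<Longrightarrow> sigma_finite_measure (count_space A)"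
  by (rule sigma_finite_measure_count_space_countable)

text \<open>
  The label space is \<open>{1..K}\<close>, and \<open>p x y\<close> stands for \<open>p(x|y)\<close>. Such functions are total in HOL, but
  only their values for \<open>x \<in> space mu\<close> and \<open>y \<in> {1..K}\<close> are relevant.
\<close>

definition cond_density :: "'a measure \<Rightarrow> nat \<Rightarrow> ('a \<Rightarrow> nat \<Rightarrow> real) \<Rightarrow> bool" where
  "cond_density mu K p \<longleftrightarrow>
     (\<forall>y\<in>{1..K}. (\<lambda>x. p x y) \<in> borel_measurable mu \<and> (\<forall>x\<in>space mu. 0 \<le> p x y) \<and>
        (\<integral>\<^sup>+x. ennreal (p x y) \<partial>mu) = 1)"

definition cond_dist_space :: "'a measure \<Rightarrow> nat \<Rightarrow> ('a \<Rightarrow> nat \<Rightarrow> real) set \<Rightarrow> bool" where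
  "cond_dist_space mu K P \<longleftrightarrow> (\<forall>p\<in>P. cond_density mu K p)"

definition joint_dist :: "'a measure \<Rightarrow> nat \<Rightarrow> nat pmf \<Rightarrow> ('a \<Rightarrow> nat \<Rightarrow> real) \<Rightarrow> ('a \<times> nat) measure" where
  "joint_dist mu K pY p =
     density (mu \<Otimes>\<^sub>M count_space {1..K}) (\<lambda>(x, y). ennreal (p x y * pmf pY y))"

text \<open>A dataset of size \<open>n\<close> is a function \<open>S\<close> on \<open>{1..n}\<close> with \<open>S i = (x\<^sub>i, y\<^sub>i)\<close>.\<close>

definition dataset_dist ::
    "'a measure \<Rightarrow> nat \<Rightarrow> nat pmf \<Rightarrow> ('a \<Rightarrow> nat \<Rightarrow> real) \<Rightarrow> nat \<Rightarrow> (nat \<Rightarrow> 'a \<times> nat) measure" where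
  "dataset_dist mu K pY p n = (\<Pi>\<^sub>M i\<in>{1..n}. joint_dist mu K pY p)"

definition cond_likelihood ::
    "nat \<Rightarrow> (nat \<Rightarrow> 'a \<times> nat) \<Rightarrow> ('a \<Rightarrow> nat \<Rightarrow> real) \<Rightarrow> real" where
  "cond_likelihood n S p = (\<Prod>i\<in>{1..n}. p (fst (S i)) (snd (S i)))"

definition avg_TV ::
    "'a measure \<Rightarrow> nat pmf \<Rightarrow> ('a \<Rightarrow> nat \<Rightarrow> real) \<Rightarrow> ('a \<Rightarrow> nat \<Rightarrow> real) \<Rightarrow> real" where
  "avg_TV mu pY pstar p =
     measure_pmf.expectation pY (\<lambda>y. 1 / 2 * (\<integral>x. \<bar>p x y - pstar x y\<bar> \<partial>mu))"

definition Lp_norm :: "'a measure \<Rightarrow> ennreal \<Rightarrow> ('a \<Rightarrow> real) \<Rightarrow> ennreal" where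
  "Lp_norm M p f =
     (if p = \<infinity> then esssup M (\<lambda>x. ennreal \<bar>f x\<bar>)
      else let I = (\<integral>\<^sup>+x. ennreal (\<bar>f x\<bar> powr enn2real p) \<partial>M)
           in if I = \<infinity> then \<infinity> else ennreal (enn2real I powr (1 / enn2real p)))"

text \<open>
  Measurability of the bracket functions is implicit in speaking of the \<open>L\<^sup>p\<close> norm of
  \<open>p' - p\<close>. It has to be explicit here, since \<open>nn_integral\<close> is also defined (as a lower integral)
  for functions that are not measurable.
\<close>

definition upper_bracket ::
    "'a measure \<Rightarrow> nat \<Rightarrow> real \<Rightarrow> ('a \<Rightarrow> nat \<Rightarrow> real) set \<Rightarrow> ennreal \<Rightarrow> ('a \<Rightarrow> nat \<Rightarrow> real) set \<Rightarrow> bool" where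
  "upper_bracket mu K \<epsilon> P p B \<longleftrightarrow>
     finite B \<and>
     (\<forall>b\<in>B. \<forall>y\<in>{1..K}. (\<lambda>x. b x y) \<in> borel_measurable mu) \<and>
     (\<forall>q\<in>P. \<exists>b\<in>B. \<forall>y\<in>{1..K}.
        (\<forall>x\<in>space mu. q x y \<le> b x y) \<and>
        Lp_norm mu p (\<lambda>x. b x y - q x y) \<le> ennreal \<epsilon>)"

text \<open>The infimum of the empty set in \<open>enat\<close> is \<open>\<infinity>\<close>.\<close>

definition upper_bracketing_number ::
    "'a measure \<Rightarrow> nat \<Rightarrow> real \<Rightarrow> ('a \<Rightarrow> nat \<Rightarrow> real) set \<Rightarrow> ennreal \<Rightarrow> enat" where
  "upper_bracketing_number mu K \<epsilon> P p = (INF B\<in>{B. upper_bracket mu K \<epsilon> P p B}. enat (card B))"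

definition ln_enat :: "enat \<Rightarrow> ereal" where
  "ln_enat N = (case N of enat k \<Rightarrow> if k = 0 then -\<infinity> else ereal (ln (real k)) | \<infinity> \<Rightarrow> \<infinity>)"

text \<open>The value at negative arguments is irrelevant.\<close>

definition sqrt_ereal :: "ereal \<Rightarrow> ereal" where
  "sqrt_ereal x = (if x = \<infinity> then \<infinity> else ereal (sqrt (real_of_ereal x)))"

end

theory Submission
  imports Defs
begin

text \<open>
  For a bracket function \<open>b\<close> let \<open>\<rho> b = E\<^sub>Y \<integral> \<surd>(b p\<^sup>*)\<close> and \<open>Z b S = \<Prod>\<^sub>i \<surd>(b / p\<^sup>*)(x\<^sub>i, y\<^sub>i)\<close>.
  Since \<open>E Z b = (\<rho> b)\<^sup>n\<close>, Markov's inequality and a union bound show that, outside an event of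
  probability at most \<open>\<delta>\<close>, \<open>Z b < 1\<close> for all \<open>b\<close> with \<open>(\<rho> b)\<^sup>n \<le> \<delta> / N\<close>. The bracket function \<open>b\<close> above
  the maximum likelihood estimate satisfies \<open>Z b \<ge> 1\<close>, because the likelihood of the estimate is
  at least that of \<open>p\<^sup>*\<close>. Hence \<open>1 - \<rho> b \<le> - ln (\<rho> b) \<le> s\<^sup>2\<close> with \<open>s\<^sup>2 = ln (N / \<delta>) / n\<close>, so \<open>b\<close> is close to \<open>p\<^sup>*\<close>
  in Hellinger distance, hence in \<open>L\<^sup>1\<close>, and \<open>b\<close> is within \<open>1 / n\<close> of the estimate in \<open>L\<^sup>1\<close>. The
  assumption \<open>\<delta> \<le> 1 / 2\<close> makes \<open>1 / n\<close> at most \<open>3 s\<^sup>2 / 2\<close>.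
\<close>

section \<open>Markov bound for products of likelihood ratios\<close>

text \<open>Markov's inequality at threshold 1; the expectation of the product factorizes because
  the coordinates are independent and identically distributed.\<close>

lemma emeasure_PiM_prod_ge_1_le:
  fixes f :: "'a \<Rightarrow> ennreal"
  assumes "prob_space M" and I: "finite I" and f[measurable]: "f \<in> borel_measurable M"
  shows "emeasure (Pi\<^sub>M I (\<lambda>_. M)) {\<omega> \<in> space (Pi\<^sub>M I (\<lambda>_. M)). 1 \<le> (\<Prod>i\<in>I. f (\<omega> i))}
    \<le> (\<integral>\<^sup>+x. f x \<partial>M) ^ card I"
proof -
  interpret prob_space M by fact
  interpret product_sigma_finite "\<lambda>_. M"
    by unfold_locales
  let ?PM = "Pi\<^sub>M I (\<lambda>_. M)"
  have "emeasure ?PM {\<omega> \<in> space ?PM. 1 \<le> 1 * (\<Prod>i\<in>I. f (\<omega> i))}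
      \<le> 1 * (\<integral>\<^sup>+\<omega>. (\<Prod>i\<in>I. f (\<omega> i)) * indicator (space ?PM) \<omega> \<partial>?PM)"
    using I by (intro nn_integral_Markov_inequality) auto
  also have "\<dots> = (\<integral>\<^sup>+\<omega>. (\<Prod>i\<in>I. f (\<omega> i)) \<partial>?PM)"
    by (auto intro!: nn_integral_cong)
  also have "\<dots> = (\<integral>\<^sup>+x. f x \<partial>M) ^ card I"
    using I by (subst product_nn_integral_prod) auto
  finally show ?thesis by simp
qed

text \<open>Pointwise \<open>p x * sqrt (b x / p x) = sqrt (b x * p x)\<close>; where
  \<open>p x = 0\<close> both sides vanish. Negative values of \<open>b\<close>, which bracket
  functions may take, are covered as well: \<open>sqrt\<close> is odd, and \<open>ennreal\<close>
  sends the negative values on both sides to 0.\<close>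

lemma nn_integral_sqrt_likelihood_ratio:
  assumes [measurable]: "p \<in> borel_measurable M" "b \<in> borel_measurable M"
    and "\<And>x. x \<in> space M \<Longrightarrow> 0 \<le> p x"
  shows "(\<integral>\<^sup>+x. ennreal (sqrt (b x / p x)) \<partial>density M (\<lambda>x. ennreal (p x)))
    = (\<integral>\<^sup>+x. ennreal (sqrt (b x * p x)) \<partial>M)"
proof -
  have "p x * sqrt (b x / p x) = sqrt (b x * p x)" if "x \<in> space M" for x
  proof (cases "p x = 0")
    case False
    then show ?thesis
      using assms(3)[OF that] by (simp add: real_sqrt_mult real_sqrt_divide field_simps)
  qed simp
  then show ?thesis
    using assms(3) by (subst nn_integral_density) (auto intro!: nn_integral_cong simp flip: ennreal_mult')
qed

section \<open>From Hellinger affinity to L1 distance\<close>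

text \<open>The geometric mean is dominated by the arithmetic mean, hence by
  \<open>f x + g x\<close>.\<close>

lemma integrable_sqrt_mult:
  fixes f g :: "'a \<Rightarrow> real"
  assumes "integrable M f" "\<And>x. x \<in> space M \<Longrightarrow> 0 \<le> f x"
    and "integrable M g" "\<And>x. x \<in> space M \<Longrightarrow> 0 \<le> g x"
  shows "integrable M (\<lambda>x. sqrt (f x * g x))"
proof (rule Bochner_Integration.integrable_bound)
  show "integrable M (\<lambda>x. f x + g x)"
    using assms by auto
  show "AE x in M. norm (sqrt (f x * g x)) \<le> norm (f x + g x)"
  proof (rule AE_I2)
    fix x assume "x \<in> space M"
    then have "0 \<le> f x" "0 \<le> g x"
      using assms by auto
    then show "norm (sqrt (f x * g x)) \<le> norm (f x + g x)"
      using arith_geo_mean_sqrt[of "f x" "g x"] by simp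
  qed
qed (use assms in measurable)

text \<open>
  Writing \<open>\<bar>b - p\<bar> = \<bar>\<surd>b - \<surd>p\<bar> (\<surd>b + \<surd>p)\<close>, a weighted AM-GM inequality replaces Cauchy-Schwarz;
  the weight \<open>4 / (3 s)\<close> nearly balances the bounds \<open>7 s\<^sup>2 / 2\<close> and \<open>6\<close> for the two integrals
  of squares.
\<close>

lemma L1_dist_le_of_affinity:
  fixes p q b :: "'a \<Rightarrow> real"
  assumes p: "integrable M p" "\<And>x. x \<in> space M \<Longrightarrow> 0 \<le> p x" "(\<integral>x. p x \<partial>M) = 1"
    and q: "integrable M q" "\<And>x. x \<in> space M \<Longrightarrow> 0 \<le> q x" "(\<integral>x. q x \<partial>M) = 1"
    and b: "integrable M b" "\<And>x. x \<in> space M \<Longrightarrow> q x \<le> b x" "(\<integral>x. b x - q x \<partial>M) \<le> e"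
    and e: "e \<le> 1" "2 * e \<le> 3 * s\<^sup>2" and s: "0 < s"
    and affinity: "1 - s\<^sup>2 \<le> (\<integral>x. sqrt (b x * p x) \<partial>M)"
  shows "(\<integral>x. \<bar>q x - p x\<bar> \<partial>M) \<le> 6 * s"
proof -
  have b0: "0 \<le> b x" if "x \<in> space M" for x
    using q(2) b(2) that by force
  have [measurable]: "p \<in> borel_measurable M" "b \<in> borel_measurable M"
    using p(1) b(1) by auto
  have sqrt_int: "integrable M (\<lambda>x. sqrt (b x * p x))"
    using b(1) b0 p(1,2) by (rule integrable_sqrt_mult)
  have int_bq: "integrable M (\<lambda>x. b x - q x)"
    using b q by auto
  have e0: "0 \<le> e"
    using b(2) by (intro order_trans[OF integral_nonneg_AE b(3)] AE_I2) simp
  have int_b: "(\<integral>x. b x \<partial>M) \<le> 1 + e"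
    using b q by simp
  define \<rho> where "\<rho> = (\<integral>x. sqrt (b x * p x) \<partial>M)"
  define t where "t = 4 / (3 * s)"
  have t: "t > 0" using s by (simp add: t_def)
  \<comment> \<open>Pointwise majorant of \<open>\<bar>b x - p x\<bar>\<close>: the first summand is
    t/2 times the squared Hellinger integrand, the second bounds the square of the sum of the roots,
    divided by 2t, by means of (u + v)^2 \<le> 2(u^2 + v^2). In this form the integral of
    \<open>h\<close> is affine in \<open>\<rho>\<close>.\<close>
  define h where "h = (\<lambda>x. t / 2 * (b x + p x - 2 * sqrt (b x * p x)) + 1 / t * (b x + p x))"
  have int_h: "integrable M h"
    unfolding h_def using b p sqrt_int by auto
  have abs_le: "\<bar>b x - p x\<bar> \<le> h x" if x: "x \<in> space M" for x
  proof -
    define u v where "u = sqrt (b x)" and "v = sqrt (p x)"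
    have uv: "b x = u\<^sup>2" "p x = v\<^sup>2" "sqrt (b x * p x) = u * v" "0 \<le> u" "0 \<le> v"
      using b0[OF x] p(2)[OF x] by (auto simp: u_def v_def real_sqrt_mult)
    have "0 \<le> (t * \<bar>u - v\<bar> - (u + v))\<^sup>2 / (2 * t)"
      using t by simp
    also have "\<dots> = t / 2 * \<bar>u - v\<bar>\<^sup>2 + 1 / (2 * t) * (u + v)\<^sup>2 - \<bar>u - v\<bar> * (u + v)"
      using t by (simp add: power2_eq_square field_simps)
    finally have "\<bar>u - v\<bar> * (u + v) \<le> t / 2 * (u - v)\<^sup>2 + 1 / (2 * t) * (u + v)\<^sup>2"
      by simp
    moreover have "(u + v)\<^sup>2 \<le> 2 * (u\<^sup>2 + v\<^sup>2)"
      using sum_squares_bound[of u v] by (simp add: power2_sum)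
    then have "1 / (2 * t) * (u + v)\<^sup>2 \<le> 1 / (2 * t) * (2 * (u\<^sup>2 + v\<^sup>2))"
      using t by (intro mult_left_mono) auto
    moreover have "\<bar>b x - p x\<bar> = \<bar>u - v\<bar> * (u + v)"
      using uv by (simp add: square_diff_square_factored power2_eq_square abs_mult)
    ultimately show ?thesis
      unfolding h_def uv(3) by (simp add: uv(1,2) power2_diff algebra_simps)
  qed
  have "(\<integral>x. \<bar>q x - p x\<bar> \<partial>M) \<le> (\<integral>x. (b x - q x) + h x \<partial>M)"
    using abs_le b(2) p q b int_h
    by (intro integral_mono) (auto, smt (verit))
  also have "\<dots> = (\<integral>x. b x - q x \<partial>M) + (\<integral>x. h x \<partial>M)"
    using int_bq int_h by (rule Bochner_Integration.integral_add)
  also have "(\<integral>x. h x \<partial>M) = t / 2 * ((\<integral>x. b x \<partial>M) + 1 - 2 * \<rho>) + 1 / t * ((\<integral>x. b x \<partial>M) + 1)"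
    unfolding h_def \<rho>_def using b p sqrt_int by simp
  \<comment> \<open>The first factor is at most (1 + e) + 1 - 2(1 - s^2) = e + 2s^2 \<le> 7/2 s^2
    because 2e \<le> 3s^2; the second is at most 2 + e \<le> 3.\<close>
  also have "\<dots> \<le> t / 2 * (7 / 2 * s\<^sup>2) + 1 / t * 3"
    using int_b e affinity t unfolding \<rho>_def[symmetric]
    by (intro add_mono mult_left_mono) auto
  also have "\<dots> = (7 / 3 + 9 / 4) * s"
    using s by (simp add: t_def power2_eq_square field_simps)
  \<comment> \<open>Since e \<le> 1, e^2 \<le> e \<le> 3/2 s^2, and 3/2 is below (5/4)^2 = 25/16.
    The constants add up to 7/3 + 9/4 + 5/4 = 35/6 \<le> 6.\<close>
  also have "(\<integral>x. b x - q x \<partial>M) \<le> 5 / 4 * s"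
  proof -
    have "e\<^sup>2 \<le> e"
      using e0 e(1) by (simp add: power2_eq_square mult_left_le)
    also have "e \<le> (5 / 4 * s)\<^sup>2"
      unfolding power_mult_distrib power_divide using e(2) zero_le_power2[of s] by (simp; linarith)
    finally have "e \<le> 5 / 4 * s"
      by (rule power2_le_imp_le) (use s in simp)
    with b(3) show ?thesis by simp
  qed
  finally show ?thesis using s by simp
qed

section \<open>The data space with labels weighted by their distribution\<close>

text \<open>Putting the label weights into the reference measure makes a conditional density an
  ordinary density on pairs, so the average over labels becomes a single integral and the preceding
  lemmas about one measure apply.\<close>

definition labelled_measure :: "'a measure \<Rightarrow> nat \<Rightarrow> nat pmf \<Rightarrow> ('a \<times> nat) measure" where
  "labelled_measure mu K pY =
     density (mu \<Otimes>\<^sub>M count_space {1..K}) (\<lambda>z. ennreal (pmf pY (snd z)))"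

lemma space_labelled_measure: "space (labelled_measure mu K pY) = space mu \<times> {1..K}"
  by (simp add: labelled_measure_def space_pair_measure)

text \<open>Joint measurability follows from that of each slice because there are only finitely many
  labels.\<close>

lemma measurable_labelled:
  fixes K :: nat and f :: "'a \<Rightarrow> nat \<Rightarrow> 'b"
  assumes "\<And>y. y \<in> {1..K} \<Longrightarrow> (\<lambda>x. f x y) \<in> mu \<rightarrow>\<^sub>M N"
  shows "(\<lambda>z. f (fst z) (snd z)) \<in> mu \<Otimes>\<^sub>M count_space {1..K} \<rightarrow>\<^sub>M N"
proof (rule measurable_compose_countable'[where f = "\<lambda>y z. f (fst z) y" and g = snd and I = "{1..K}"])
  show "(\<lambda>z. f (fst z) y) \<in> mu \<Otimes>\<^sub>M count_space {1..K} \<rightarrow>\<^sub>M N" if "y \<in> {1..K}" for y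
    by (rule measurable_compose[OF measurable_fst assms[OF that]])
  show "snd \<in> mu \<Otimes>\<^sub>M count_space {1..K} \<rightarrow>\<^sub>M count_space {1..K}"
    by (rule measurable_snd)
qed simp

lemma measurable_pmf_label [measurable]:
  fixes pY :: "nat pmf"
  shows "(\<lambda>z. ennreal (pmf pY (snd z))) \<in> borel_measurable (mu \<Otimes>\<^sub>M count_space {1..K})"
  by (rule measurable_labelled[where f = "\<lambda>_ y. ennreal (pmf pY y)"]) simp

lemma measurable_labelled_measure:
  assumes "\<And>y. y \<in> {1..K} \<Longrightarrow> (\<lambda>x. f x y) \<in> mu \<rightarrow>\<^sub>M N"
  shows "(\<lambda>z. f (fst z) (snd z)) \<in> labelled_measure mu K pY \<rightarrow>\<^sub>M N"
  unfolding labelled_measure_def measurable_density_eq1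
  by (rule measurable_labelled) (rule assms)

text \<open>Tonelli, with the integral over the labels written as a finite sum.\<close>

lemma nn_integral_labelled_measure:
  assumes "sigma_finite_measure mu"
    and f: "\<And>y. y \<in> {1..K} \<Longrightarrow> (\<lambda>x. f x y) \<in> borel_measurable mu"
  shows "(\<integral>\<^sup>+z. f (fst z) (snd z) \<partial>labelled_measure mu K pY)
    = (\<Sum>y\<in>{1..K}. ennreal (pmf pY y) * (\<integral>\<^sup>+x. f x y \<partial>mu))"
proof -
  interpret mu: sigma_finite_measure mu by fact
  interpret C: sigma_finite_measure "count_space {1..K}"
    by (simp add: sigma_finite_measure_count_space_finite)
  interpret pair_sigma_finite mu "count_space {1..K}" ..
  let ?g = "\<lambda>z. ennreal (pmf pY (snd z)) * f (fst z) (snd z)"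
  have [measurable]: "(\<lambda>z. f (fst z) (snd z)) \<in> borel_measurable (mu \<Otimes>\<^sub>M count_space {1..K})"
    using f by (intro measurable_labelled)
  have "(\<integral>\<^sup>+z. f (fst z) (snd z) \<partial>labelled_measure mu K pY)
      = (\<integral>\<^sup>+z. ?g z \<partial>(mu \<Otimes>\<^sub>M count_space {1..K}))"
    unfolding labelled_measure_def by (rule nn_integral_density) measurable
  also have "\<dots> = (\<integral>\<^sup>+y. \<integral>\<^sup>+x. ?g (x, y) \<partial>mu \<partial>count_space {1..K})"
    by (rule nn_integral_snd[symmetric]) measurable
  also have "\<dots> = (\<Sum>y\<in>{1..K}. ennreal (pmf pY y) * (\<integral>\<^sup>+x. f x y \<partial>mu))"
    using f by (simp add: nn_integral_count_space_finite nn_integral_cmult)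
  finally show ?thesis .
qed

lemma sum_pmf_eq_1_ennreal:
  assumes "finite A" "set_pmf p \<subseteq> A"
  shows "(\<Sum>y\<in>A. ennreal (pmf p y)) = 1"
  using sum_pmf_eq_1[OF assms] by (simp add: sum_ennreal)

lemma Lp_norm_1: "Lp_norm M 1 f = (\<integral>\<^sup>+x. ennreal \<bar>f x\<bar> \<partial>M)"
  by (auto simp: Lp_norm_def Let_def powr_one ennreal_enn2real_if)

text \<open>Successive densities multiply: the factor \<open>pmf pY y\<close> goes into the
  reference measure and \<open>p\<close> remains as the density.\<close>

lemma joint_dist_eq_density:
  assumes "\<And>y. y \<in> {1..K} \<Longrightarrow> (\<lambda>x. p x y) \<in> borel_measurable mu"
    and "\<And>x y. x \<in> space mu \<Longrightarrow> y \<in> {1..K} \<Longrightarrow> 0 \<le> p x y"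
  shows "joint_dist mu K pY p
    = density (labelled_measure mu K pY) (\<lambda>z. ennreal (p (fst z) (snd z)))"
proof -
  have "(\<lambda>z. p (fst z) (snd z)) \<in> borel_measurable (mu \<Otimes>\<^sub>M count_space {1..K})"
    using assms(1) by (intro measurable_labelled)
  then have m[measurable]: "(\<lambda>z. ennreal (p (fst z) (snd z))) \<in> borel_measurable (mu \<Otimes>\<^sub>M count_space {1..K})"
    by measurable
  show ?thesis
    unfolding joint_dist_def labelled_measure_def density_density_eq[OF measurable_pmf_label m]
  proof (rule density_cong)
    show "(\<lambda>(x, y). ennreal (p x y * pmf pY y)) \<in> borel_measurable (mu \<Otimes>\<^sub>M count_space {1..K})"
      unfolding split_beta'
      by (rule measurable_labelled[where f = "\<lambda>x y. ennreal (p x y * pmf pY y)"]) (use assms(1) in auto)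
    show "AE z in mu \<Otimes>\<^sub>M count_space {1..K}. (case z of (x, y) \<Rightarrow> ennreal (p x y * pmf pY y))
        = ennreal (pmf pY (snd z)) * ennreal (p (fst z) (snd z))"
      using assms(2) by (intro AE_I2) (auto simp: space_pair_measure ennreal_mult'' mult.commute)
  qed measurable
qed

text \<open>Turns the average total variation into half of one L1 distance, the quantity that the
  Hellinger argument controls.\<close>

lemma avg_TV_eq:
  assumes "sigma_finite_measure mu" "set_pmf pY \<subseteq> {1..K}"
    and p: "cond_density mu K p" and q: "cond_density mu K q"
  shows "avg_TV mu pY p q
    = 1 / 2 * (\<integral>z. \<bar>q (fst z) (snd z) - p (fst z) (snd z)\<bar> \<partial>labelled_measure mu K pY)"
proof -
  have m: "(\<lambda>x. p x y) \<in> borel_measurable mu" "(\<lambda>x. q x y) \<in> borel_measurable mu"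
    if "y \<in> {1..K}" for y
    using p q that by (auto simp: cond_density_def)
  have "integrable mu (\<lambda>x. r x y)" if "y \<in> {1..K}" "cond_density mu K r" for y r
    using that by (intro integrableI_nonneg) (auto simp: cond_density_def)
  then have int: "integrable mu (\<lambda>x. \<bar>q x y - p x y\<bar>)" if "y \<in> {1..K}" for y
    using p q that by auto
  have "avg_TV mu pY p q = (\<Sum>y\<in>{1..K}. pmf pY y * (1 / 2 * (\<integral>x. \<bar>q x y - p x y\<bar> \<partial>mu)))"
    unfolding avg_TV_def using assms(2) by (subst integral_measure_pmf[of "{1..K}"]) auto
  also have "\<dots> = 1 / 2 * (\<Sum>y\<in>{1..K}. pmf pY y * (\<integral>x. \<bar>q x y - p x y\<bar> \<partial>mu))"
    by (simp add: sum_distrib_left mult_ac)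
  also have "(\<Sum>y\<in>{1..K}. pmf pY y * (\<integral>x. \<bar>q x y - p x y\<bar> \<partial>mu))
      = (\<integral>z. \<bar>q (fst z) (snd z) - p (fst z) (snd z)\<bar> \<partial>labelled_measure mu K pY)"
  proof -
    \<comment> \<open>The exchange of sum and integral is done for nonnegative integrals in
      \<open>ennreal\<close>; integrability of the slices permits the lift and
      \<open>enn2real\<close> undoes it.\<close>
    have "ennreal (\<Sum>y\<in>{1..K}. pmf pY y * (\<integral>x. \<bar>q x y - p x y\<bar> \<partial>mu))
        = (\<Sum>y\<in>{1..K}. ennreal (pmf pY y) * (\<integral>\<^sup>+x. ennreal \<bar>q x y - p x y\<bar> \<partial>mu))"
      using int by (simp add: sum_ennreal[symmetric] ennreal_mult nn_integral_eq_integral)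
    also have "\<dots> = (\<integral>\<^sup>+z. ennreal \<bar>q (fst z) (snd z) - p (fst z) (snd z)\<bar> \<partial>labelled_measure mu K pY)"
      using m by (subst nn_integral_labelled_measure[OF assms(1)]) auto
    finally have eq: "ennreal (\<Sum>y\<in>{1..K}. pmf pY y * (\<integral>x. \<bar>q x y - p x y\<bar> \<partial>mu)) = \<dots>" .
    have "(\<lambda>z. \<bar>q (fst z) (snd z) - p (fst z) (snd z)\<bar>) \<in> borel_measurable (labelled_measure mu K pY)"
      using m by (intro measurable_labelled_measure) auto
    then have "(\<integral>z. \<bar>q (fst z) (snd z) - p (fst z) (snd z)\<bar> \<partial>labelled_measure mu K pY)
        = enn2real (\<integral>\<^sup>+z. ennreal \<bar>q (fst z) (snd z) - p (fst z) (snd z)\<bar> \<partial>labelled_measure mu K pY)"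
      by (intro integral_eq_nn_integral) auto
    then show ?thesis
      by (simp add: sum_nonneg flip: eq)
  qed
  finally show ?thesis .
qed

lemma nn_integral_cond_density:
  assumes "sigma_finite_measure mu" "set_pmf pY \<subseteq> {1..K}" "cond_density mu K p"
  shows "(\<integral>\<^sup>+z. ennreal (p (fst z) (snd z)) \<partial>labelled_measure mu K pY) = 1"
proof -
  have "(\<integral>\<^sup>+z. ennreal (p (fst z) (snd z)) \<partial>labelled_measure mu K pY)
      = (\<Sum>y\<in>{1..K}. ennreal (pmf pY y) * (\<integral>\<^sup>+x. ennreal (p x y) \<partial>mu))"
    using assms by (intro nn_integral_labelled_measure) (auto simp: cond_density_def)
  also have "\<dots> = (\<Sum>y\<in>{1..K}. ennreal (pmf pY y))"
    using assms(3) by (intro sum.cong) (auto simp: cond_density_def)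
  also have "\<dots> = 1"
    using assms(2) by (intro sum_pmf_eq_1_ennreal) auto
  finally show ?thesis .
qed

section \<open>Upper brackets of conditional densities\<close>

text \<open>A value other than \<infinity> means that some bracket exists, and \<open>enat\<close>
  is well-ordered, so the infimum of a nonempty set is one of its elements.\<close>

lemma upper_bracketing_number_attained:
  assumes "upper_bracketing_number mu K e P p \<noteq> \<infinity>"
  obtains B where "upper_bracket mu K e P p B" "upper_bracketing_number mu K e P p = enat (card B)"
proof -
  let ?A = "(\<lambda>B. enat (card B)) ` {B. upper_bracket mu K e P p B}"
  have "?A \<noteq> {}"
    using assms unfolding upper_bracketing_number_def Inf_enat_def by meson
  then have "Inf ?A \<in> ?A"
    unfolding Inf_enat_def by (auto intro: LeastI)
  then show ?thesis
    using that by (auto simp: upper_bracketing_number_def)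
qed

text \<open>Replacing \<open>b\<close> by the smaller \<open>q\<close> leaves the square root of the
  likelihood ratio of \<open>q\<close> to \<open>p\<close>, which is at least 1. It is applied with
  \<open>q\<close> the maximum likelihood estimate and \<open>b\<close> the bracket function above
  it.\<close>

lemma prod_sqrt_likelihood_ratio_ge_1:
  fixes p q b :: "'i \<Rightarrow> real"
  assumes "\<And>i. i \<in> I \<Longrightarrow> 0 < p i" "\<And>i. i \<in> I \<Longrightarrow> 0 \<le> q i" "\<And>i. i \<in> I \<Longrightarrow> q i \<le> b i"
    and "prod p I \<le> prod q I"
  shows "1 \<le> (\<Prod>i\<in>I. ennreal (sqrt (b i / p i)))"
proof -
  have p: "0 < prod p I"
    using assms(1) by (intro prod_pos) auto
  have sqrt_prod: "sqrt (prod f I) = (\<Prod>i\<in>I. sqrt (f i))" for f :: "'i \<Rightarrow> real"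
    by (induction I rule: infinite_finite_induct) (auto simp: real_sqrt_mult)
  have "1 \<le> sqrt (prod q I / prod p I)"
    using assms(4) p by simp
  also have "\<dots> = (\<Prod>i\<in>I. sqrt (q i / p i))"
    using sqrt_prod[of "\<lambda>i. q i / p i"] by (simp add: prod_dividef)
  also have "\<dots> \<le> (\<Prod>i\<in>I. sqrt (b i / p i))"
    using assms by (intro prod_mono) (auto intro!: divide_right_mono simp: less_imp_le)
  finally have "ennreal 1 \<le> ennreal (\<Prod>i\<in>I. sqrt (b i / p i))"
    by (rule ennreal_leI)
  also have "\<dots> = (\<Prod>i\<in>I. ennreal (sqrt (b i / p i)))"
    using assms by (intro prod_ennreal[symmetric]) (force intro!: divide_nonneg_pos)
  finally show ?thesis by simp
qed

text \<open>The bound \<open>e\<close> holds for every label and the label weights sum to 1, so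
  averaging preserves it; \<open>q \<le> b\<close> removes the absolute value in the norm.\<close>

lemma cond_density_in_bracket_L1:
  assumes sf: "sigma_finite_measure mu" and pY: "set_pmf pY \<subseteq> {1..K}"
    and q: "cond_density mu K q"
    and b: "\<And>y. y \<in> {1..K} \<Longrightarrow> (\<lambda>x. b x y) \<in> borel_measurable mu"
    and qb: "\<And>x y. x \<in> space mu \<Longrightarrow> y \<in> {1..K} \<Longrightarrow> q x y \<le> b x y"
    and norm: "\<And>y. y \<in> {1..K} \<Longrightarrow> Lp_norm mu 1 (\<lambda>x. b x y - q x y) \<le> ennreal e"
  shows "(\<integral>\<^sup>+z. ennreal (b (fst z) (snd z) - q (fst z) (snd z)) \<partial>labelled_measure mu K pY) \<le> ennreal e"
proof -
  have "(\<integral>\<^sup>+z. ennreal (b (fst z) (snd z) - q (fst z) (snd z)) \<partial>labelled_measure mu K pY)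
      = (\<Sum>y\<in>{1..K}. ennreal (pmf pY y) * (\<integral>\<^sup>+x. ennreal (b x y - q x y) \<partial>mu))"
    using q by (subst nn_integral_labelled_measure[OF sf])
      (auto simp: cond_density_def intro!: b measurable_compose[OF borel_measurable_diff measurable_ennreal])
  also have "\<dots> \<le> (\<Sum>y\<in>{1..K}. ennreal (pmf pY y) * ennreal e)"
  proof (intro sum_mono mult_left_mono)
    fix y assume y: "y \<in> {1..K}"
    have "(\<integral>\<^sup>+x. ennreal (b x y - q x y) \<partial>mu) = Lp_norm mu 1 (\<lambda>x. b x y - q x y)"
      unfolding Lp_norm_1 using qb[OF _ y] by (intro nn_integral_cong) auto
    with norm[OF y] show "(\<integral>\<^sup>+x. ennreal (b x y - q x y) \<partial>mu) \<le> ennreal e"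
      by simp
  qed auto
  also have "\<dots> = ennreal e"
    using pY by (simp add: sum_pmf_eq_1_ennreal del: sum_ennreal flip: sum_distrib_right)
  finally show ?thesis .
qed

text \<open>Instance of \<open>L1_dist_le_of_affinity\<close> on \<open>labelled_measure\<close>;
  the factor 1/2 of total variation turns 6s into 3s.\<close>

lemma avg_TV_le_of_affinity:
  assumes sf: "sigma_finite_measure mu" and pY: "set_pmf pY \<subseteq> {1..K}"
    and p: "cond_density mu K p" and q: "cond_density mu K q"
    and b: "\<And>y. y \<in> {1..K} \<Longrightarrow> (\<lambda>x. b x y) \<in> borel_measurable mu"
    and qb: "\<And>x y. x \<in> space mu \<Longrightarrow> y \<in> {1..K} \<Longrightarrow> q x y \<le> b x y"
    and norm: "\<And>y. y \<in> {1..K} \<Longrightarrow> Lp_norm mu 1 (\<lambda>x. b x y - q x y) \<le> ennreal e"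
    and e: "0 \<le> e" "e \<le> 1" "2 * e \<le> 3 * s\<^sup>2" and s: "0 < s"
    and affinity: "ennreal (1 - s\<^sup>2)
      \<le> (\<integral>\<^sup>+z. ennreal (sqrt (b (fst z) (snd z) * p (fst z) (snd z))) \<partial>labelled_measure mu K pY)"
  shows "avg_TV mu pY p q \<le> 3 * s"
proof -
  let ?\<nu> = "labelled_measure mu K pY"
  let ?p = "\<lambda>z. p (fst z) (snd z)" and ?q = "\<lambda>z. q (fst z) (snd z)" and ?b = "\<lambda>z. b (fst z) (snd z)"
  have m[measurable]: "?p \<in> borel_measurable ?\<nu>" "?q \<in> borel_measurable ?\<nu>" "?b \<in> borel_measurable ?\<nu>"
    using p q b by (auto intro!: measurable_labelled_measure simp: cond_density_def)
  have nonneg: "0 \<le> ?p z" "0 \<le> ?q z" "?q z \<le> ?b z" if "z \<in> space ?\<nu>" for z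
    using that p q qb by (auto simp: space_labelled_measure cond_density_def)
  have b0: "0 \<le> ?b z" if "z \<in> space ?\<nu>" for z
    using nonneg(2,3)[OF that] by linarith
  have bq: "(\<integral>\<^sup>+z. ennreal (?b z - ?q z) \<partial>?\<nu>) \<le> ennreal e"
    using sf pY q b qb norm by (rule cond_density_in_bracket_L1)
  have p1: "integrable ?\<nu> ?p" "(\<integral>z. ?p z \<partial>?\<nu>) = 1"
    using nn_integral_cond_density[OF sf pY p] nonneg
    by (auto intro!: integrableI_nonneg simp: integral_eq_nn_integral)
  have q1: "integrable ?\<nu> ?q" "(\<integral>z. ?q z \<partial>?\<nu>) = 1"
    using nn_integral_cond_density[OF sf pY q] nonneg
    by (auto intro!: integrableI_nonneg simp: integral_eq_nn_integral)
  have bq_int: "integrable ?\<nu> (\<lambda>z. ?b z - ?q z)"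
    using bq nonneg by (auto intro!: integrableI_nonneg elim: le_less_trans)
  \<comment> \<open>A bracket function is only known to be measurable; it is integrable as the sum
    of \<open>q\<close> and the gap \<open>b - q\<close>.\<close>
  then have b_int: "integrable ?\<nu> ?b"
    using q1 by (metis (no_types, lifting) Bochner_Integration.integrable_add
        Bochner_Integration.integrable_cong diff_add_cancel)
  have bq_e: "(\<integral>z. ?b z - ?q z \<partial>?\<nu>) \<le> e"
    using bq bq_int nonneg e(1) by (simp add: nn_integral_eq_integral)
  have sqrt_int: "integrable ?\<nu> (\<lambda>z. sqrt (?b z * ?p z))"
    using b_int b0 p1(1) nonneg(1) by (rule integrable_sqrt_mult)
  have bp: "0 \<le> ?b z * ?p z" if "z \<in> space ?\<nu>" for z
    using nonneg(1)[OF that] b0[OF that] by simp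
  \<comment> \<open>Nonnegativity of this integral lets the \<open>ennreal\<close> inequality be
    read in the reals, whatever the sign of \<open>1 - s\<^sup>2\<close>.\<close>
  have "0 \<le> (\<integral>z. sqrt (?b z * ?p z) \<partial>?\<nu>)"
    using bp by (intro integral_nonneg_AE AE_I2) simp
  moreover have "(\<integral>\<^sup>+z. ennreal (sqrt (?b z * ?p z)) \<partial>?\<nu>) = ennreal (\<integral>z. sqrt (?b z * ?p z) \<partial>?\<nu>)"
    using sqrt_int bp by (intro nn_integral_eq_integral AE_I2) simp_all
  ultimately have "1 - s\<^sup>2 \<le> (\<integral>z. sqrt (?b z * ?p z) \<partial>?\<nu>)"
    using affinity by (simp add: ennreal_le_iff)
  with p1(1) nonneg(1) p1(2) q1(1) nonneg(2) q1(2) b_int nonneg(3) bq_e e(2,3) s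
  have "(\<integral>z. \<bar>?q z - ?p z\<bar> \<partial>?\<nu>) \<le> 6 * s"
    by (rule L1_dist_le_of_affinity)
  then show ?thesis
    by (simp add: avg_TV_eq[OF sf pY p q])
qed

section \<open>The law of one observation\<close>

lemma prob_space_joint_dist:
  assumes "sigma_finite_measure mu" "set_pmf pY \<subseteq> {1..K}" and p: "cond_density mu K p"
  shows "prob_space (joint_dist mu K pY p)"
proof
  have eq: "joint_dist mu K pY p
      = density (labelled_measure mu K pY) (\<lambda>z. ennreal (p (fst z) (snd z)))"
    using p by (intro joint_dist_eq_density) (auto simp: cond_density_def)
  have "(\<lambda>z. p (fst z) (snd z)) \<in> borel_measurable (labelled_measure mu K pY)"
    using p by (intro measurable_labelled_measure) (auto simp: cond_density_def)
  then have "emeasure (joint_dist mu K pY p) (space (joint_dist mu K pY p))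
      = (\<integral>\<^sup>+z. ennreal (p (fst z) (snd z)) \<partial>labelled_measure mu K pY)"
    unfolding eq by (subst emeasure_density) (auto intro!: nn_integral_cong)
  then show "emeasure (joint_dist mu K pY p) (space (joint_dist mu K pY p)) = 1"
    using nn_integral_cond_density[OF assms] by simp
qed

text \<open>The zero set of a density is null for the measure it defines; this justifies dividing by
  the true density at the sample points.\<close>

lemma AE_joint_dist_pos:
  assumes "cond_density mu K p"
  shows "AE z in joint_dist mu K pY p. 0 < p (fst z) (snd z)"
proof -
  have eq: "joint_dist mu K pY p
      = density (labelled_measure mu K pY) (\<lambda>z. ennreal (p (fst z) (snd z)))"
    using assms by (intro joint_dist_eq_density) (auto simp: cond_density_def)
  have "(\<lambda>z. p (fst z) (snd z)) \<in> borel_measurable (labelled_measure mu K pY)"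
    using assms by (intro measurable_labelled_measure) (auto simp: cond_density_def)
  then show ?thesis
    unfolding eq by (subst AE_density) auto
qed

section \<open>Union bound over the bracket\<close>

text \<open>Taking logarithms, ln c \<le> n ln \<rho> \<le> n(\<rho> - 1). With \<open>c\<close>
  equal to \<delta>/N the left side of the conclusion is 1 - s^2.\<close>

lemma one_minus_le_of_power_ge:
  fixes \<rho> :: ennreal
  assumes "0 < c" "0 < n" "ennreal c \<le> \<rho> ^ n"
  shows "ennreal (1 - ln (1 / c) / real n) \<le> \<rho>"
proof (cases \<rho>)
  case (real r)
  then have "c \<le> r ^ n"
    using assms by (simp add: ennreal_power)
  moreover from this have "0 < r"
    using assms real by (cases "r = 0") (auto simp: zero_power)
  ultimately have "ln c \<le> real n * ln r"
    using assms by (metis ln_le_cancel_iff ln_realpow less_le_trans)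
  also have "\<dots> \<le> real n * (r - 1)"
    using \<open>0 < r\<close> by (intro mult_left_mono ln_le_minus_one) auto
  finally have "1 - ln (1 / c) / real n \<le> r"
    using assms by (simp add: ln_div field_simps)
  then show ?thesis
    using real by (simp add: ennreal_leI)
qed simp

text \<open>\<open>Bad\<close> is fixed before \<open>S\<close> and \<open>b\<close>, so the
  conclusion may be used for a bracket function chosen after seeing the sample, as the one above the
  estimate is.\<close>

lemma likelihood_ratio_union_bound:
  fixes p :: "'a \<Rightarrow> real" and f :: "'b \<Rightarrow> 'a \<Rightarrow> real" and M :: "'a measure" and I :: "'i set"
  defines "J \<equiv> density M (\<lambda>x. ennreal (p x))"
  assumes J: "prob_space J"
    and p[measurable]: "p \<in> borel_measurable M" and p0: "\<And>x. x \<in> space M \<Longrightarrow> 0 \<le> p x"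
    and B: "finite B" and f: "\<And>b. b \<in> B \<Longrightarrow> f b \<in> borel_measurable M"
    and I: "finite I" and \<delta>: "0 \<le> \<delta>"
  obtains Bad where "Bad \<in> sets (Pi\<^sub>M I (\<lambda>_. J))" "measure (Pi\<^sub>M I (\<lambda>_. J)) Bad \<le> \<delta>"
    "\<And>S b. S \<in> space (Pi\<^sub>M I (\<lambda>_. J)) - Bad \<Longrightarrow> b \<in> B \<Longrightarrow>
       1 \<le> (\<Prod>i\<in>I. ennreal (sqrt (f b (S i) / p (S i)))) \<Longrightarrow>
       ennreal (\<delta> / real (card B)) \<le> (\<integral>\<^sup>+x. ennreal (sqrt (f b x * p x)) \<partial>M) ^ card I"
proof -
  let ?D = "Pi\<^sub>M I (\<lambda>_. J)"
  have D: "prob_space ?D"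
    using J by (intro prob_space_PiM)
  define \<rho> where "\<rho> b = (\<integral>\<^sup>+x. ennreal (sqrt (f b x * p x)) \<partial>M)" for b
  define A where "A b = {S \<in> space ?D. 1 \<le> (\<Prod>i\<in>I. ennreal (sqrt (f b (S i) / p (S i))))}" for b
  \<comment> \<open>The functions whose affinity is so small that Markov's inequality gives
    probability at most \<delta>/N each. Every other member of \<open>B\<close> satisfies the
    required lower bound by the choice of \<open>B'\<close>.\<close>
  define B' where "B' = {b \<in> B. \<rho> b ^ card I \<le> ennreal (\<delta> / real (card B))}"
  have B': "finite B'" "B' \<subseteq> B"
    using B by (auto simp: B'_def)
  have ratio: "(\<lambda>x. ennreal (sqrt (f b x / p x))) \<in> borel_measurable J" if "b \<in> B" for b
    using f[OF that] by (simp add: J_def)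
  have A_sets: "A b \<in> sets ?D" if "b \<in> B" for b
  proof -
    note [measurable] = ratio[OF that]
    show ?thesis
      unfolding A_def by measurable
  qed
  have A_le: "emeasure ?D (A b) \<le> \<rho> b ^ card I" if "b \<in> B" for b
  proof -
    have "emeasure ?D (A b) \<le> (\<integral>\<^sup>+x. ennreal (sqrt (f b x / p x)) \<partial>J) ^ card I"
      unfolding A_def using J I ratio[OF that] by (rule emeasure_PiM_prod_ge_1_le)
    also have "\<dots> = \<rho> b ^ card I"
      unfolding J_def \<rho>_def using f[OF that] p0
      by (subst nn_integral_sqrt_likelihood_ratio) auto
    finally show ?thesis .
  qed
  have "emeasure ?D (\<Union>b\<in>B'. A b) \<le> (\<Sum>b\<in>B'. emeasure ?D (A b))"
    using B' A_sets by (intro emeasure_subadditive_finite) auto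
  also have "\<dots> \<le> (\<Sum>b\<in>B'. ennreal (\<delta> / real (card B)))"
    using A_le by (intro sum_mono) (auto simp: B'_def intro: order_trans)
  also have "\<dots> = ennreal (real (card B') * (\<delta> / real (card B)))"
    using \<delta> by (subst ennreal_mult) (auto simp: ennreal_of_nat_eq_real_of_nat)
  also have "\<dots> \<le> ennreal \<delta>"
  proof (rule ennreal_leI)
    have "real (card B') * \<delta> \<le> real (card B) * \<delta>"
      using card_mono[OF B B'(2)] \<delta> by (intro mult_right_mono) auto
    \<comment> \<open>For \<open>card B = 0\<close> the quotient is 0 by convention and the claim
      reads 0 \<le> \<delta>.\<close>
    then show "real (card B') * (\<delta> / real (card B)) \<le> \<delta>"
      using \<delta> by (cases "card B = 0") (auto simp: field_simps)
  qed
  finally have Bad_le: "measure ?D (\<Union>b\<in>B'. A b) \<le> \<delta>"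
    using \<delta> by (simp add: finite_measure.emeasure_eq_measure[OF prob_space.finite_measure[OF D]])
  have Bad_sets: "(\<Union>b\<in>B'. A b) \<in> sets ?D"
    using B' A_sets by (intro sets.finite_UN) auto
  show ?thesis
  proof (rule that[OF Bad_sets Bad_le])
    fix S b
    assume S: "S \<in> space ?D - (\<Union>b\<in>B'. A b)" and b: "b \<in> B"
      and "1 \<le> (\<Prod>i\<in>I. ennreal (sqrt (f b (S i) / p (S i))))"
    then have "S \<in> A b"
      by (simp add: A_def)
    with S have "b \<notin> B'"
      by auto
    with b show "ennreal (\<delta> / real (card B)) \<le> (\<integral>\<^sup>+x. ennreal (sqrt (f b x * p x)) \<partial>M) ^ card I"
      by (simp add: B'_def \<rho>_def)
  qed
qed

section \<open>The bound for a fixed sample outside the exceptional events\<close>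

text \<open>Deterministic half of the argument: \<open>pos\<close>, \<open>max\<close> and
  \<open>affinity\<close> are the properties of the sample that hold off the exceptional events.
  They force large affinity for the bracket function above \<open>q\<close>, hence closeness of
  \<open>q\<close> to \<open>p\<close>.\<close>

lemma avg_TV_mle_le:
  assumes sf: "sigma_finite_measure mu" and pY: "set_pmf pY \<subseteq> {1..K}"
    and P: "cond_dist_space mu K P" "p \<in> P" "q \<in> P"
    and n: "n \<ge> 1" and \<delta>: "0 < \<delta>" "\<delta> \<le> 1 / 2"
    and B: "upper_bracket mu K (1 / real n) P 1 B"
    and S: "\<And>i. i \<in> {1..n} \<Longrightarrow> S i \<in> space mu \<times> {1..K}"
    and pos: "\<And>i. i \<in> {1..n} \<Longrightarrow> 0 < p (fst (S i)) (snd (S i))"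
    and max: "cond_likelihood n S p \<le> cond_likelihood n S q"
    and affinity: "\<And>b. b \<in> B \<Longrightarrow>
      1 \<le> (\<Prod>i\<in>{1..n}. ennreal (sqrt (b (fst (S i)) (snd (S i)) / p (fst (S i)) (snd (S i))))) \<Longrightarrow>
      ennreal (\<delta> / real (card B))
        \<le> (\<integral>\<^sup>+z. ennreal (sqrt (b (fst z) (snd z) * p (fst z) (snd z))) \<partial>labelled_measure mu K pY) ^ n"
  shows "avg_TV mu pY p q \<le> 3 * sqrt (ln (real (card B) / \<delta>) / real n)"
proof -
  have p: "cond_density mu K p" and q: "cond_density mu K q"
    using P by (auto simp: cond_dist_space_def)
  obtain b where b: "b \<in> B"
    and qb: "\<And>x y. x \<in> space mu \<Longrightarrow> y \<in> {1..K} \<Longrightarrow> q x y \<le> b x y"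
    and norm: "\<And>y. y \<in> {1..K} \<Longrightarrow> Lp_norm mu 1 (\<lambda>x. b x y - q x y) \<le> ennreal (1 / real n)"
    using B P(3) unfolding upper_bracket_def by blast
  have b_meas: "(\<lambda>x. b x y) \<in> borel_measurable mu" if "y \<in> {1..K}" for y
    using B b that by (auto simp: upper_bracket_def)
  have "finite B"
    using B by (simp add: upper_bracket_def)
  with b have k: "1 \<le> card B"
    by (metis One_nat_def Suc_leI card_gt_0_iff empty_iff)
  define s where "s = sqrt (ln (real (card B) / \<delta>) / real n)"
  \<comment> \<open>As \<delta> \<le> 1/2 and the bracket is nonempty, n s^2 \<ge> ln 2 \<ge> 2/3.
    This gives s > 0 and the condition 2e \<le> 3s^2 for e = 1/n.\<close>
  have "2 \<le> real (card B) / \<delta>"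
    using k \<delta> by (simp add: field_simps)
  then have "ln 2 \<le> ln (real (card B) / \<delta>)"
    by (subst ln_le_cancel_iff) auto
  then have L: "2 / 3 \<le> ln (real (card B) / \<delta>)"
    using ln2_ge_two_thirds by linarith
  then have s2: "s\<^sup>2 = ln (real (card B) / \<delta>) / real n" and s: "0 < s"
    using n by (auto simp: s_def)
  have "1 \<le> (\<Prod>i\<in>{1..n}. ennreal (sqrt (b (fst (S i)) (snd (S i)) / p (fst (S i)) (snd (S i)))))"
  proof (rule prod_sqrt_likelihood_ratio_ge_1[where q = "\<lambda>i. q (fst (S i)) (snd (S i))"])
    show "0 \<le> q (fst (S i)) (snd (S i))" if "i \<in> {1..n}" for i
      using S[OF that] q by (auto simp: cond_density_def)
    show "q (fst (S i)) (snd (S i)) \<le> b (fst (S i)) (snd (S i))" if "i \<in> {1..n}" for i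
      using S[OF that] by (intro qb) auto
  qed (use pos max in \<open>auto simp: cond_likelihood_def\<close>)
  then have "ennreal (1 - s\<^sup>2)
      \<le> (\<integral>\<^sup>+z. ennreal (sqrt (b (fst z) (snd z) * p (fst z) (snd z))) \<partial>labelled_measure mu K pY)"
    using one_minus_le_of_power_ge[OF _ _ affinity[OF b]] k n \<delta> by (simp add: s2)
  moreover have "2 * (1 / real n) \<le> 3 * s\<^sup>2"
    using n L by (simp add: s2 field_simps)
  ultimately have "avg_TV mu pY p q \<le> 3 * s"
    using n s by (intro avg_TV_le_of_affinity[OF sf pY p q b_meas qb norm]) auto
  then show ?thesis
    by (simp add: s_def)
qed

section \<open>The law of the dataset and the final estimate\<close>

lemma prob_space_dataset_dist:
  assumes "sigma_finite_measure mu" "set_pmf pY \<subseteq> {1..K}" "cond_density mu K p"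
  shows "prob_space (dataset_dist mu K pY p n)"
  unfolding dataset_dist_def using prob_space_joint_dist[OF assms] by (intro prob_space_PiM)

lemma AE_dataset_dist_pos:
  assumes "sigma_finite_measure mu" "set_pmf pY \<subseteq> {1..K}" "cond_density mu K p"
  shows "AE S in dataset_dist mu K pY p n. \<forall>i\<in>{1..n}. 0 < p (fst (S i)) (snd (S i))"
proof (rule AE_finite_allI)
  fix i assume "i \<in> {1..n}"
  then show "AE S in dataset_dist mu K pY p n. 0 < p (fst (S i)) (snd (S i))"
    unfolding dataset_dist_def
    by (intro AE_PiM_component[where P = "\<lambda>z. 0 < p (fst z) (snd z)"]
        prob_space_joint_dist[OF assms] AE_joint_dist_pos[OF assms(3)])
qed simp

lemma space_dataset_dist:
  assumes "S \<in> space (dataset_dist mu K pY p n)" "i \<in> {1..n}"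
  shows "S i \<in> space mu \<times> {1..K}"
proof -
  have "S i \<in> space (joint_dist mu K pY p)"
    using assms by (auto simp: dataset_dist_def space_PiM)
  then show ?thesis
    by (simp add: joint_dist_def space_pair_measure)
qed

text \<open>The union bound with \<open>labelled_measure\<close> as reference measure, so that the
  product of the densities is \<open>dataset_dist\<close> and the exponent is
  \<open>n\<close>.\<close>

lemma bracket_affinity_bound:
  assumes sf: "sigma_finite_measure mu" and pY: "set_pmf pY \<subseteq> {1..K}" and p: "cond_density mu K p"
    and B: "upper_bracket mu K e P r B" and \<delta>: "0 \<le> \<delta>"
  obtains Bad where "Bad \<in> sets (dataset_dist mu K pY p n)" "measure (dataset_dist mu K pY p n) Bad \<le> \<delta>"
    "\<And>S b. S \<in> space (dataset_dist mu K pY p n) - Bad \<Longrightarrow> b \<in> B \<Longrightarrow>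
       1 \<le> (\<Prod>i\<in>{1..n}. ennreal (sqrt (b (fst (S i)) (snd (S i)) / p (fst (S i)) (snd (S i))))) \<Longrightarrow>
       ennreal (\<delta> / real (card B))
         \<le> (\<integral>\<^sup>+z. ennreal (sqrt (b (fst z) (snd z) * p (fst z) (snd z))) \<partial>labelled_measure mu K pY) ^ n"
proof -
  let ?\<nu> = "labelled_measure mu K pY"
  have J_eq: "joint_dist mu K pY p = density ?\<nu> (\<lambda>z. ennreal (p (fst z) (snd z)))"
    using p by (intro joint_dist_eq_density) (auto simp: cond_density_def)
  have D_eq: "dataset_dist mu K pY p n
      = Pi\<^sub>M {1..n} (\<lambda>_. density ?\<nu> (\<lambda>z. ennreal (p (fst z) (snd z))))"
    by (simp add: dataset_dist_def J_eq)
  have prob: "prob_space (density ?\<nu> (\<lambda>z. ennreal (p (fst z) (snd z))))"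
    using prob_space_joint_dist[OF sf pY p] by (simp add: J_eq)
  have p_meas: "(\<lambda>z. p (fst z) (snd z)) \<in> borel_measurable ?\<nu>"
    using p by (intro measurable_labelled_measure) (auto simp: cond_density_def)
  have p0: "0 \<le> p (fst z) (snd z)" if "z \<in> space ?\<nu>" for z
    using that p by (auto simp: space_labelled_measure cond_density_def)
  have fin: "finite B"
    using B by (simp add: upper_bracket_def)
  have b_meas: "(\<lambda>z. b (fst z) (snd z)) \<in> borel_measurable ?\<nu>" if "b \<in> B" for b
    using B that by (intro measurable_labelled_measure) (auto simp: upper_bracket_def)
  show ?thesis
    by (rule likelihood_ratio_union_bound[where f = "\<lambda>b z. b (fst z) (snd z)" and I = "{1..n}",
          OF prob p_meas _ fin _ _ \<delta>])
      (erule p0, erule b_meas, simp, rule that[unfolded D_eq], simp_all)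
qed

theorem theorem3p2:
  fixes mu :: "'a measure"
    and K n :: nat
    and pY :: "nat pmf"
    and pstar :: "'a \<Rightarrow> nat \<Rightarrow> real"
    and P :: "('a \<Rightarrow> nat \<Rightarrow> real) set"
    and phat :: "(nat \<Rightarrow> 'a \<times> nat) \<Rightarrow> 'a \<Rightarrow> nat \<Rightarrow> real"
    and \<delta> :: real
  assumes data_space: "sigma_finite_measure mu"
    and labels: "set_pmf pY \<subseteq> {1..K}"
    and P: "cond_dist_space mu K P"
    and pstar: "pstar \<in> P"
    and n: "n \<ge> 1"
    and MLE: "AE S in dataset_dist mu K pY pstar n.
                is_arg_max (cond_likelihood n S) (\<lambda>p. p \<in> P) (phat S)"
    and delta: "0 < \<delta>" "\<delta> \<le> 1 / 2"
  shows "\<exists>E \<in> sets (dataset_dist mu K pY pstar n).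
           measure (dataset_dist mu K pY pstar n) E \<ge> 1 - \<delta> \<and>
           (\<forall>S\<in>E. ereal (avg_TV mu pY pstar (phat S))
              \<le> 3 * sqrt_ereal (ereal (1 / real n) *
                    (ln_enat (upper_bracketing_number mu K (1 / real n) P 1) + ereal (ln (1 / \<delta>)))))"
proof -
  let ?D = "dataset_dist mu K pY pstar n"
  let ?N = "upper_bracketing_number mu K (1 / real n) P 1"
  have ps: "cond_density mu K pstar"
    using pstar P by (simp add: cond_dist_space_def)
  have D: "prob_space ?D"
    using data_space labels ps by (rule prob_space_dataset_dist)
  show ?thesis
  proof (cases "?N = \<infinity>")
    \<comment> \<open>The right-hand side is \<infinity>, since 1/n is positive, so the whole space
      serves as the event.\<close>
    case True
    then show ?thesis
      using n delta by (intro bexI[of _ "space ?D"])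
        (auto simp: prob_space.prob_space[OF D] ln_enat_def sqrt_ereal_def)
  next
    case False
    then obtain B where B: "upper_bracket mu K (1 / real n) P 1 B" and N: "?N = enat (card B)"
      by (rule upper_bracketing_number_attained)
    \<comment> \<open>Some bracket function must lie above \<open>pstar\<close>; hence the branch of
      \<open>ln_enat\<close> with value -\<infinity> does not occur.\<close>
    have "B \<noteq> {}" "finite B"
      using B pstar by (auto simp: upper_bracket_def)
    then have k: "0 < card B"
      by (simp add: card_gt_0_iff)
    then have "ln (real (card B) / \<delta>) = ln (real (card B)) + ln (1 / \<delta>)"
      using delta by (simp add: ln_div)
    then have bound: "3 * sqrt_ereal (ereal (1 / real n) * (ln_enat ?N + ereal (ln (1 / \<delta>))))
        = ereal (3 * sqrt (ln (real (card B) / \<delta>) / real n))"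
      using k by (simp add: N ln_enat_def sqrt_ereal_def)
    obtain Bad where Bad: "Bad \<in> sets ?D" "measure ?D Bad \<le> \<delta>"
      and affinity: "\<And>S b. S \<in> space ?D - Bad \<Longrightarrow> b \<in> B \<Longrightarrow>
        1 \<le> (\<Prod>i\<in>{1..n}. ennreal (sqrt (b (fst (S i)) (snd (S i)) / pstar (fst (S i)) (snd (S i))))) \<Longrightarrow>
        ennreal (\<delta> / real (card B)) \<le> (\<integral>\<^sup>+z. ennreal (sqrt (b (fst z) (snd z) * pstar (fst z) (snd z)))
          \<partial>labelled_measure mu K pY) ^ n"
      by (rule bracket_affinity_bound[OF data_space labels ps B less_imp_le[OF delta(1)], of n])
        (rule that)
    from MLE AE_dataset_dist_pos[OF data_space labels ps, of n]
    have "AE S in ?D. is_arg_max (cond_likelihood n S) (\<lambda>p. p \<in> P) (phat S)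
        \<and> (\<forall>i\<in>{1..n}. 0 < pstar (fst (S i)) (snd (S i)))"
      by eventually_elim auto
    \<comment> \<open>The samples violating the almost sure properties need not form a measurable
      set; \<open>Null\<close> is a measurable null set containing them, which makes the final event
      measurable.\<close>
    then obtain Null where Null: "Null \<in> null_sets ?D"
      and good: "\<And>S. S \<in> space ?D - Null \<Longrightarrow> is_arg_max (cond_likelihood n S) (\<lambda>p. p \<in> P) (phat S)
        \<and> (\<forall>i\<in>{1..n}. 0 < pstar (fst (S i)) (snd (S i)))"
      by (rule AE_E3) blast
    have sets_bad: "Null \<union> Bad \<in> sets ?D"
      using Null Bad by auto
    have "measure ?D (Null \<union> Bad) \<le> \<delta>"
      using measure_Un_null_set[OF Bad(1) Null] Bad(2) by (simp add: Un_commute)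
    then have prob: "1 - \<delta> \<le> measure ?D (space ?D - (Null \<union> Bad))"
      by (subst prob_space.prob_compl[OF D sets_bad]) simp
    have TV: "avg_TV mu pY pstar (phat S) \<le> 3 * sqrt (ln (real (card B) / \<delta>) / real n)"
      if S: "S \<in> space ?D - (Null \<union> Bad)" for S
    proof (rule avg_TV_mle_le[OF data_space labels P pstar _ n delta B])
      \<comment> \<open>Since \<open>pstar\<close> belongs to \<open>P\<close>, it competes in the
        maximization, and its likelihood cannot exceed that of the estimate.\<close>
      show "phat S \<in> P" "cond_likelihood n S pstar \<le> cond_likelihood n S (phat S)"
        "\<And>i. i \<in> {1..n} \<Longrightarrow> 0 < pstar (fst (S i)) (snd (S i))"
        using good[of S] S pstar by (auto simp: is_arg_max_def not_less)
      show "\<And>i. i \<in> {1..n} \<Longrightarrow> S i \<in> space mu \<times> {1..K}"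
        using S by (intro space_dataset_dist) auto
    qed (use S in \<open>intro affinity; simp\<close>)
    show ?thesis
      unfolding bound using prob sets_bad TV
      by (intro bexI[of _ "space ?D - (Null \<union> Bad)"]) auto
  qed
qed

end
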